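(* Let $d \ge 1$ be an integer, let $P \subseteq \mathbb{R}^d$ be nonempty, let $t \ge 2$ be a fixed integer and $c > 0$ a real number, and let $Q_{P,t,c} = \{(x_1, \dots, x_d, y) : (x_1, \dots, x_d) \in P,\ y \in \{c, 2c, \dots, tc\}\} \subseteq \mathbb{R}^{d+1}$. Then $$\operatorname{opx}(n, Q_{P,t,c}, d+1) = O\left(\operatorname{opx}(n, P, d)^{\frac1t}\, n^{d+1-\frac dt} + n^d\right),$$ where the implied constant depends on $t$ and $c$.
   Context: Containment for subsets of $\mathbb{R}^d$: for $P, S \subseteq \mathbb{R}^d$, let $C_i(P)$ and $C_i(S)$ be the sets of all $i$-th coordinates of points of $P$ and $S$. $S$ contains $P$ if there exist functions $f_i : C_i(P) \to C_i(S)$ for $i = 1, \dots, d$ such that (1) for each $i$, $\frac{f_i(x)-f_i(x')}{x-x'} \ge 1$ for all $x > x'$ in $C_i(P)$; (2) $(f_1(x_1), \dots, f_d(x_d)) \in S$ for all $(x_1, \dots, x_d) \in P$. Otherwise $S$ is $P$-free. For real $n > 0$, $\operatorname{opx}(n,P,d)$ is the supremum of the $d$-dimensional Lebesgue measure $\mu_d(S)$ over all open (in $\mathbb{R}^d$) $P$-free subsets $S \subseteq [0,n]^d$. $f(n) = O(g(n))$ means there is a constant $C > 0$ with $f(n) \le C g(n)$ for all sufficiently large real $n$. *)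

theory Defs
  imports "HOL-Analysis.Analysis"
begin

text \<open>
  The dimension has to vary inside a statement, so points of \<open>\<real>\<^sup>d\<close> are extensional functions
  \<open>x :: nat \<Rightarrow> real\<close> on \<open>{..<d}\<close>: the paper's coordinates \<open>1, \<dots>, d\<close> are numbered \<open>0, \<dots>, d - 1\<close>.
\<close>

definition Rspace :: "nat \<Rightarrow> (nat \<Rightarrow> real) set" where
  "Rspace d = (\<Pi>\<^sub>E i\<in>{..<d}. UNIV)"

definition cube :: "nat \<Rightarrow> real \<Rightarrow> (nat \<Rightarrow> real) set" where
  "cube d n = (\<Pi>\<^sub>E i\<in>{..<d}. {0..n})"

definition open_in_Rspace :: "nat \<Rightarrow> (nat \<Rightarrow> real) set \<Rightarrow> bool" where
  "open_in_Rspace d S \<longleftrightarrow> openin (product_topology (\<lambda>_. euclideanreal) {..<d}) S"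

text \<open>
  Lebesgue measure on the Borel sets of \<open>\<real>\<^sup>d\<close>. No completion is taken, since the measure is
  only applied to open sets.
\<close>

definition lebesgue_Rspace :: "nat \<Rightarrow> (nat \<Rightarrow> real) measure" where
  "lebesgue_Rspace d = PiM {..<d} (\<lambda>_. lborel)"

definition coords :: "nat \<Rightarrow> (nat \<Rightarrow> real) set \<Rightarrow> real set" where
  "coords i P = (\<lambda>x. x i) ` P"

definition contains :: "nat \<Rightarrow> (nat \<Rightarrow> real) set \<Rightarrow> (nat \<Rightarrow> real) set \<Rightarrow> bool" where
  "contains d S P \<longleftrightarrow>
     (\<exists>f :: nat \<Rightarrow> real \<Rightarrow> real.
        (\<forall>i<d. f i \<in> coords i P \<rightarrow> coords i S) \<and>
        (\<forall>i<d. \<forall>x\<in>coords i P. \<forall>x'\<in>coords i P.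
           x > x' \<longrightarrow> (f i x - f i x') / (x - x') \<ge> 1) \<and>
        (\<forall>x\<in>P. (\<lambda>i\<in>{..<d}. f i (x i)) \<in> S))"

text \<open>
  A supremum of reals: for \<open>P \<noteq> {}\<close> the set below contains \<open>0\<close> (take \<open>S = {}\<close>) and is bounded
  above by \<open>n ^ d\<close>. For \<open>P = {}\<close> it is empty and the value has no meaning.
\<close>

definition opx :: "real \<Rightarrow> (nat \<Rightarrow> real) set \<Rightarrow> nat \<Rightarrow> real" where
  "opx n P d =
     Sup {measure (lebesgue_Rspace d) S | S.
            open_in_Rspace d S \<and> S \<subseteq> cube d n \<and> \<not> contains d S P}"

text \<open>
  For \<open>P\<close> in \<open>\<real>\<^sup>d\<close>, this is a subset of \<open>\<real>\<close> to the power \<open>d + 1\<close>; the new last coordinate \<open>y\<close>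
  has index \<open>d\<close>.
\<close>

definition Qset :: "nat \<Rightarrow> (nat \<Rightarrow> real) set \<Rightarrow> nat \<Rightarrow> real \<Rightarrow> (nat \<Rightarrow> real) set" where
  "Qset d P t c = {x(d := y) | x y. x \<in> P \<and> y \<in> (\<lambda>k. real k * c) ` {1..t}}"

end

theory Submission
  imports Defs
begin

text \<open>
  If \<open>S\<close> contains no copy of \<open>Q\<^bsub>P,t,c\<^esub>\<close>, then any \<open>t\<close> slices of \<open>S\<close> at heights pairwise at least
  \<open>c\<close> apart have a \<open>P\<close>-free intersection, of measure at most \<open>p = opx n P d\<close>. For fixed \<open>\<theta>\<close> this
  applies to the \<open>N \<approx> n / c\<close> slices at heights \<open>\<theta> + k c\<close>. If \<open>h\<close> counts how many of these slices
  contain a point, the integral of \<open>h choose t\<close> is therefore at most \<open>(N choose t) p\<close>, and by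
  convexity the slices have total measure \<open>O(n\<^sup>d + N p\<^bsup>1/t\<^esup> n\<^bsup>d - d/t\<^esup>)\<close>. Integrating over
  \<open>\<theta> \<in> [0, c]\<close> bounds the measure of \<open>S\<close>.
\<close>

section \<open>Counting with multiplicity: from small \<open>t\<close>-fold intersections to a small
  total measure\<close>

text \<open>If \<open>u > a\<close>, then \<open>(u / a) ^ (t - 1) \<ge> 1\<close>, so the second
  term alone dominates \<open>u\<close>. With the free weight \<open>a\<close>, this stands in for
  the convexity argument: it is linear in \<open>u ^ t\<close> and can be integrated
  directly.\<close>

lemma le_add_power_div:
  fixes a u :: real
  assumes "a > 0" "u \<ge> 0" "t \<ge> 1"
  shows "u \<le> a + u ^ t / a ^ (t - 1)"
proof (cases "u \<le> a")
  case True
  have "0 \<le> u ^ t / a ^ (t - 1)" using assms by simp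
  with True show ?thesis by linarith
next
  case False
  obtain s where t: "t = Suc s" using assms(3) by (cases t) auto
  have "a ^ s \<le> u ^ s" using False assms by (intro power_mono) auto
  then have "u * a ^ s \<le> u * u ^ s" using assms by (intro mult_left_mono) auto
  then have "u \<le> u ^ t / a ^ (t - 1)" using assms by (simp add: t field_simps)
  with assms show ?thesis by linarith
qed

text \<open>For \<open>h \<ge> t\<close> the bound \<open>(h / t) ^ t \<le> h choose t\<close> turns
  the power in \<open>le_add_power_div\<close> into a binomial coefficient. For \<open>h < t\<close>
  that coefficient vanishes, and the summand \<open>t - 1\<close> covers \<open>h\<close>.\<close>

lemma card_le_binomial_bound:
  fixes a :: real
  assumes "a > 0" "t \<ge> 1"
  shows "real h \<le> (real t - 1 + a) + real t ^ t / a ^ (t - 1) * real (h choose t)"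
proof (cases "h < t")
  case True
  then have "real h \<le> real t - 1" by linarith
  moreover have "0 \<le> real t ^ t / a ^ (t - 1) * real (h choose t)" using assms by simp
  ultimately show ?thesis using assms by linarith
next
  case False
  then have "(real h / real t) ^ t \<le> real (h choose t)"
    using binomial_ge_n_over_k_pow_k[of t h, where ?'a = real] by simp
  then have "real h ^ t \<le> real t ^ t * real (h choose t)"
    using assms by (simp add: power_divide divide_le_eq mult.commute)
  then have "real h ^ t / a ^ (t - 1) \<le> real t ^ t / a ^ (t - 1) * real (h choose t)"
    using assms by (simp add: divide_right_mono)
  moreover have "real h \<le> a + real h ^ t / a ^ (t - 1)"
    using assms by (intro le_add_power_div) auto
  ultimately show ?thesis using assms by linarith
qed

text \<open>The inequality \<open>card_le_binomial_bound\<close>, with \<open>h\<close> the number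
  of sets \<open>A k\<close> through a point, is integrated over \<Omega>. The weight
  \<open>a\<close> stays free so that it can be optimised afterwards.\<close>

lemma sum_measure_le_weighted:
  fixes a p :: real
  assumes fin: "finite I" and A: "\<And>k. k \<in> I \<Longrightarrow> A k \<in> sets M"
    and sub: "\<And>k. k \<in> I \<Longrightarrow> A k \<subseteq> \<Omega>" and \<Omega>: "\<Omega> \<in> fmeasurable M"
    and int: "\<And>K. K \<subseteq> I \<Longrightarrow> card K = t \<Longrightarrow> measure M (\<Inter>k\<in>K. A k) \<le> p"
    and t: "t \<ge> 1" and a: "a > 0" and p: "p \<ge> 0"
  shows "(\<Sum>k\<in>I. measure M (A k))
           \<le> (real t - 1 + a) * measure M \<Omega> + real t ^ t * real (card I) ^ t * p / a ^ (t - 1)"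
proof -
  define KK where "KK = {K. K \<subseteq> I \<and> card K = t}"
  define b where "b = real t ^ t / a ^ (t - 1)"
  have b: "b \<ge> 0" using a by (simp add: b_def)
  have finKK: "finite KK" unfolding KK_def using fin by simp
  have cardKK: "card KK = card I choose t" unfolding KK_def by (rule n_subsets[OF fin])
  have KK: "K \<subseteq> I" "finite K" "K \<noteq> {}" "card K = t" if "K \<in> KK" for K
    using that t fin by (auto simp: KK_def intro: finite_subset)
  have fmA: "A k \<in> fmeasurable M" if "k \<in> I" for k
    using fmeasurableI2[OF \<Omega>] sub A that by blast
  have fmI: "(\<Inter>k\<in>K. A k) \<in> fmeasurable M" if K: "K \<in> KK" for K
  proof -
    obtain k where k: "k \<in> K" using KK(3)[OF K] by blast
    show ?thesis
    proof (rule fmeasurableI2[OF \<Omega>])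
      show "(\<Inter>k\<in>K. A k) \<subseteq> \<Omega>" using k sub KK(1)[OF K] by blast
      show "(\<Inter>k\<in>K. A k) \<in> sets M" using KK[OF K] A by (intro sets.finite_INT) auto
    qed
  qed
  have pw: "(\<Sum>k\<in>I. indicator (A k) x)
      \<le> (real t - 1 + a) * indicator \<Omega> x + b * (\<Sum>K\<in>KK. indicator (\<Inter>k\<in>K. A k) x)" for x
  proof (cases "x \<in> \<Omega>")
    case False
    then have "(\<Sum>k\<in>I. indicator (A k) x) = (0::real)"
      using sub by (intro sum.neutral) (auto simp: indicator_def)
    then show ?thesis using False b by (auto intro!: mult_nonneg_nonneg sum_nonneg)
  next
    case True
    \<comment> \<open>Here \<open>h = card J\<close>. The members of \<open>KK\<close> whose
      intersection contains \<open>x\<close> are the \<open>t\<close>-subsets of \<open>J\<close>,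
      so their indicators add up to \<open>h choose t\<close>.\<close>
    define J where "J = {k \<in> I. x \<in> A k}"
    have J: "finite J" unfolding J_def using fin by simp
    have h: "(\<Sum>k\<in>I. indicator (A k) x) = real (card J)"
      unfolding J_def Collect_conj_eq using fin by (simp add: indicator_def sum.If_cases)
    have "(\<Sum>K\<in>KK. indicator (\<Inter>k\<in>K. A k) x) = real (card {K \<in> KK. x \<in> (\<Inter>k\<in>K. A k)})"
      unfolding Collect_conj_eq using finKK by (simp add: indicator_def sum.If_cases)
    also have "{K \<in> KK. x \<in> (\<Inter>k\<in>K. A k)} = {K. K \<subseteq> J \<and> card K = t}"
      by (auto simp: KK_def J_def)
    also have "card \<dots> = card J choose t" by (rule n_subsets[OF J])
    finally show ?thesis
      using card_le_binomial_bound[OF a t, of "card J"] True by (simp add: h b_def)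
  qed
  have "(\<Sum>k\<in>I. measure M (A k)) = (\<integral>x. (\<Sum>k\<in>I. indicator (A k) x) \<partial>M)"
    using fmA by (subst Bochner_Integration.integral_sum) (auto simp: fmeasurable_def A)
  also have "\<dots> \<le> (\<integral>x. (real t - 1 + a) * indicator \<Omega> x
                     + b * (\<Sum>K\<in>KK. indicator (\<Inter>k\<in>K. A k) x) \<partial>M)"
    using fmA \<Omega> fmI pw
    by (intro integral_mono) (auto simp: fmeasurable_def intro!: Bochner_Integration.integrable_sum
        Bochner_Integration.integrable_add integrable_mult_right)
  also have "\<dots> = (real t - 1 + a) * measure M \<Omega> + b * (\<Sum>K\<in>KK. measure M (\<Inter>k\<in>K. A k))"
    using \<Omega> fmI
    by (subst Bochner_Integration.integral_add)
       (auto simp: fmeasurable_def intro!: Bochner_Integration.integrable_sum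
          Bochner_Integration.integrable_add integrable_mult_right)
  also have "\<dots> \<le> (real t - 1 + a) * measure M \<Omega> + b * (real (card I) ^ t * p)"
  proof -
    have "(\<Sum>K\<in>KK. measure M (\<Inter>k\<in>K. A k)) \<le> real (card KK) * p"
      using int by (intro sum_bounded_above) (auto simp: KK_def)
    \<comment> \<open>The factorial in \<open>(N choose t) * t! \<le> N ^ t\<close> is dropped,
      which costs only a factor depending on \<open>t\<close>.\<close>
    moreover have "real (card KK) \<le> real (card I) ^ t"
      unfolding cardKK using binomial_fact_pow[of "card I" t]
      by (metis fact_ge_1 le_trans mult_le_mono2 nat_mult_1_right of_nat_le_iff of_nat_power)
    then have "real (card KK) * p \<le> real (card I) ^ t * p"
      using p by (rule mult_right_mono)
    ultimately show ?thesis using b by (intro add_left_mono mult_left_mono) linarith+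
  qed
  also have "\<dots> = (real t - 1 + a) * measure M \<Omega> + real t ^ t * real (card I) ^ t * p / a ^ (t - 1)"
    by (simp add: b_def)
  finally show ?thesis .
qed

text \<open>The weighted bound holds for every \<open>a > 0\<close>; balancing its two terms in
  \<open>a\<close> yields the exponents \<open>1 / t\<close> and \<open>1 - 1 / t\<close>.\<close>

lemma sum_measure_le:
  fixes p :: real
  assumes fin: "finite I" and A: "\<And>k. k \<in> I \<Longrightarrow> A k \<in> sets M"
    and sub: "\<And>k. k \<in> I \<Longrightarrow> A k \<subseteq> \<Omega>" and \<Omega>: "\<Omega> \<in> fmeasurable M"
    and int: "\<And>K. K \<subseteq> I \<Longrightarrow> card K = t \<Longrightarrow> measure M (\<Inter>k\<in>K. A k) \<le> p"
    and t: "t \<ge> 1" and p: "p \<ge> 0"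
  shows "(\<Sum>k\<in>I. measure M (A k))
           \<le> (real t - 1) * measure M \<Omega>
             + 2 * real t * real (card I) * p powr (1 / real t) * measure M \<Omega> powr (1 - 1 / real t)"
proof -
  define m where "m = measure M \<Omega>"
  define L where "L = (\<Sum>k\<in>I. measure M (A k))"
  define N where "N = real (card I)"
  have weighted: "L \<le> (real t - 1 + a) * m + real t ^ t * N ^ t * p / a ^ (t - 1)" if "a > 0" for a
    unfolding L_def m_def N_def by (rule sum_measure_le_weighted[OF assms(1-6) that p])
  have rhs: "0 \<le> (real t - 1) * m + 2 * real t * N * p powr (1 / real t) * m powr (1 - 1 / real t)"
    using t by (simp add: m_def N_def)
  have "L \<le> (real t - 1) * m + 2 * real t * N * p powr (1 / real t) * m powr (1 - 1 / real t)"
  \<comment> \<open>The balancing weight is \<open>t * N * (p / m) powr (1 / t)\<close>. It must be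
    positive, so vanishing \<open>m\<close>, \<open>N\<close> or \<open>p\<close> are treated
    separately.\<close>
  proof (cases "m = 0 \<or> I = {}")
    case True
    then have "L \<le> 0"
    proof
      assume m: "m = 0"
      have "measure M (A k) \<le> m" if "k \<in> I" for k
        unfolding m_def using sub A \<Omega> that by (intro measure_mono_fmeasurable) auto
      then show "L \<le> 0" unfolding L_def m by (intro sum_nonpos)
    qed (simp add: L_def)
    with rhs show ?thesis by linarith
  next
    case False
    then have m: "m > 0" by (simp add: m_def less_le)
    have N: "N > 0" using False fin by (simp add: N_def card_gt_0_iff)
    show ?thesis
    proof (cases "p = 0")
      case True
      \<comment> \<open>For \<open>p = 0\<close> the balancing weight would be 0; instead
        \<open>a = e / m\<close> tends to 0 with \<open>e\<close>.\<close>
      have "L \<le> (real t - 1) * m + e" if "e > 0" for e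
        using weighted[of "e / m"] that m True by (simp add: algebra_simps)
      then have "L \<le> (real t - 1) * m" by (rule field_le_epsilon)
      then show ?thesis using True by simp
    next
      case False
      with p have p: "p > 0" by simp
      define r where "r = (p / m) powr (1 / real t)"
      \<comment> \<open>this choice of \<open>a\<close> makes the two terms containing it equal\<close>
      define a where "a = real t * N * r"
      have r: "r > 0" using p m by (simp add: r_def)
      have a: "a > 0" using t N r by (simp add: a_def)
      have "r ^ t = p / m" using t p m by (simp add: r_def powr_power)
      then have pm: "p = m * r ^ t" using m by (simp add: field_simps)
      obtain s where s: "t = Suc s" using t by (cases t) auto
      have "real t ^ t * N ^ t * p = m * a * a ^ (t - 1)"
        unfolding pm a_def by (simp add: s power_mult_distrib)
      then have "real t ^ t * N ^ t * p / a ^ (t - 1) = m * a" using a by simp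
      then have "L \<le> (real t - 1) * m + 2 * (m * a)"
        using weighted[OF a] by (simp add: algebra_simps)
      also have "m * a = real t * N * p powr (1 / real t) * m powr (1 - 1 / real t)"
        using m p by (simp add: a_def r_def powr_divide powr_diff)
      finally show ?thesis by simp
    qed
  qed
  then show ?thesis unfolding L_def m_def N_def .
qed

section \<open>Open sets, cubes and the extremal function\<close>

lemma topspace_Rspace: "topspace (product_topology (\<lambda>_. euclideanreal) {..<d}) = Rspace d"
  by (simp add: Rspace_def)

lemma space_lebesgue_Rspace: "space (lebesgue_Rspace d) = Rspace d"
  by (simp add: lebesgue_Rspace_def Rspace_def space_PiM)

text \<open>Borel measurability of open sets is available for the product over all of
  \<open>nat\<close>. So \<open>S\<close> is lifted to the open cylinder \<open>T\<close> of
  functions whose restriction lies in \<open>S\<close>, and \<open>T\<close> is pulled back along a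
  measurable map from the finite product.\<close>

lemma open_in_Rspace_imp_sets:
  assumes "open_in_Rspace d S"
  shows "S \<in> sets (lebesgue_Rspace d)"
proof -
  let ?X = "product_topology (\<lambda>_::nat. euclideanreal) {..<d}"
  define T where "T = {f :: nat \<Rightarrow> real. restrict f {..<d} \<in> S}"
  have S: "openin ?X S" using assms by (simp add: open_in_Rspace_def)
  have "continuous_map (product_topology (\<lambda>_::nat. euclideanreal) UNIV) ?X (\<lambda>f. restrict f {..<d})"
    by (auto simp: continuous_map_componentwise intro!: continuous_map_product_projection)
  from openin_continuous_map_preimage[OF this S] have "open T"
    by (simp add: T_def euclidean_product_topology)
  then have "T \<in> sets (PiM UNIV (\<lambda>_::nat. borel :: real measure))"
    by (simp add: sets_PiM_equal_borel)
  \<comment> \<open>On extensional functions this map is the identity, so the preimage of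
    \<open>T\<close> is \<open>S\<close>. Written coordinatewise, each component is a projection or
    a constant, hence measurable.\<close>
  moreover have "(\<lambda>x i. if i < d then x i else undefined)
      \<in> measurable (lebesgue_Rspace d) (PiM UNIV (\<lambda>_::nat. borel :: real measure))"
    unfolding lebesgue_Rspace_def
  proof (rule measurable_PiM_single')
    fix i :: nat
    show "(\<lambda>x. if i < d then x i else undefined)
        \<in> measurable (PiM {..<d} (\<lambda>_. lborel)) (borel :: real measure)"
    proof (cases "i < d")
      case True
      then have "(\<lambda>x. x i) \<in> measurable (PiM {..<d} (\<lambda>_. lborel)) (lborel :: real measure)"
        by (intro measurable_component_singleton) simp
      with True show ?thesis by simp
    qed simp
  qed auto
  ultimately have "(\<lambda>x i. if i < d then x i else undefined) -` T \<inter> space (lebesgue_Rspace d)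
      \<in> sets (lebesgue_Rspace d)"
    by (rule measurable_sets[rotated])
  also have "(\<lambda>x i. if i < d then x i else undefined) -` T \<inter> space (lebesgue_Rspace d) = S"
  proof -
    have "restrict (\<lambda>i. if i < d then x i else undefined) {..<d} = x" if "x \<in> Rspace d" for x
      using that by (auto simp: Rspace_def PiE_iff extensional_def restrict_def)
    moreover have "S \<subseteq> Rspace d"
      using openin_subset[OF S] by (simp add: topspace_Rspace del: topspace_product_topology)
    ultimately show ?thesis by (auto simp: T_def space_lebesgue_Rspace)
  qed
  finally show ?thesis .
qed

lemma emeasure_cube:
  assumes "n \<ge> 0"
  shows "emeasure (lebesgue_Rspace d) (cube d n) = ennreal (n ^ d)"
proof -
  interpret product_sigma_finite "\<lambda>_::nat. lborel :: real measure"
    by standard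
  show ?thesis
    unfolding lebesgue_Rspace_def cube_def
    using assms by (subst emeasure_PiM) (auto simp: ennreal_power)
qed

lemma cube_sets: "cube d n \<in> sets (lebesgue_Rspace d)"
  unfolding lebesgue_Rspace_def cube_def by (rule sets_PiM_I_finite) auto

lemma cube_fmeasurable: "n \<ge> 0 \<Longrightarrow> cube d n \<in> fmeasurable (lebesgue_Rspace d)"
  by (simp add: fmeasurable_def cube_sets emeasure_cube)

lemma measure_cube: "n \<ge> 0 \<Longrightarrow> measure (lebesgue_Rspace d) (cube d n) = n ^ d"
  by (simp add: measure_def emeasure_cube)

lemma not_contains_empty: "P \<noteq> {} \<Longrightarrow> \<not> contains d {} P"
  by (auto simp: contains_def)

lemma measure_le_opx:
  assumes "n \<ge> 0" "open_in_Rspace d S" "S \<subseteq> cube d n" "\<not> contains d S P"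
  shows "measure (lebesgue_Rspace d) S \<le> opx n P d"
  unfolding opx_def
proof (rule cSup_upper)
  show "bdd_above {measure (lebesgue_Rspace d) S | S.
      open_in_Rspace d S \<and> S \<subseteq> cube d n \<and> \<not> contains d S P}"
  proof (rule bdd_aboveI)
    fix v
    assume "v \<in> {measure (lebesgue_Rspace d) S | S.
      open_in_Rspace d S \<and> S \<subseteq> cube d n \<and> \<not> contains d S P}"
    then show "v \<le> measure (lebesgue_Rspace d) (cube d n)"
      using assms(1) by (auto intro!: measure_mono_fmeasurable cube_fmeasurable open_in_Rspace_imp_sets)
  qed
qed (use assms in blast)

lemma opx_nonneg:
  assumes "n \<ge> 0" "P \<noteq> {}"
  shows "opx n P d \<ge> 0"
  using measure_le_opx[of n d "{}" P] assms not_contains_empty by (simp add: open_in_Rspace_def)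

lemma opx_le:
  assumes "P \<noteq> {}"
    and "\<And>S. open_in_Rspace d S \<Longrightarrow> S \<subseteq> cube d n \<Longrightarrow> \<not> contains d S P
           \<Longrightarrow> measure (lebesgue_Rspace d) S \<le> b"
  shows "opx n P d \<le> b"
  unfolding opx_def
proof (rule cSup_least)
  have "open_in_Rspace d {}" by (simp add: open_in_Rspace_def)
  then show "{measure (lebesgue_Rspace d) S | S.
      open_in_Rspace d S \<and> S \<subseteq> cube d n \<and> \<not> contains d S P} \<noteq> {}"
    using not_contains_empty[OF assms(1)] by blast
qed (use assms(2) in blast)

section \<open>Horizontal slices and stacked copies of \<open>P\<close>\<close>

text \<open>The update erases the value of \<open>x\<close> at index \<open>d\<close>; membership in
  \<open>Rspace d\<close> fixes that value, so each point of the section is represented exactly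
  once.\<close>

definition slice :: "nat \<Rightarrow> (nat \<Rightarrow> real) set \<Rightarrow> real \<Rightarrow> (nat \<Rightarrow> real) set" where
  "slice d S y = {x \<in> Rspace d. x(d := y) \<in> S}"

lemma open_slice:
  assumes "open_in_Rspace (Suc d) S"
  shows "open_in_Rspace d (slice d S y)"
proof -
  let ?X = "\<lambda>d::nat. product_topology (\<lambda>_. euclideanreal) {..<d}"
  have "continuous_map (?X d) (?X (Suc d)) (\<lambda>x. x(d := y))"
    unfolding continuous_map_componentwise
  proof (intro conjI ballI)
    show "(\<lambda>x. x(d := y)) ` topspace (?X d) \<subseteq> extensional {..<Suc d}"
      by (auto simp: PiE_iff extensional_def)
  next
    fix k assume "k \<in> {..<Suc d}"
    then show "continuous_map (?X d) euclideanreal (\<lambda>x. (x(d := y)) k)"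
      by (cases "k = d") (auto intro!: continuous_map_product_projection)
  qed
  from openin_continuous_map_preimage[OF this] assms show ?thesis
    unfolding open_in_Rspace_def slice_def topspace_Rspace by blast
qed

lemma slice_subset_cube:
  assumes "S \<subseteq> cube (Suc d) n"
  shows "slice d S y \<subseteq> cube d n"
proof
  fix x assume "x \<in> slice d S y"
  then have x: "x \<in> Rspace d" and "x(d := y) \<in> cube (Suc d) n"
    using assms by (auto simp: slice_def)
  then have "(x(d := y)) i \<in> {0..n}" if "i < Suc d" for i
    using that by (auto simp: cube_def PiE_iff simp del: fun_upd_apply)
  then have "x i \<in> {0..n}" if "i < d" for i
    using that by (metis fun_upd_other less_SucI less_irrefl)
  with x show "x \<in> cube d n" by (auto simp: cube_def Rspace_def PiE_iff)
qed

lemma slice_eq_empty: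
  assumes "S \<subseteq> cube (Suc d) n" "y \<notin> {0..n}"
  shows "slice d S y = {}"
proof -
  have "x(d := y) \<notin> cube (Suc d) n" for x
    using assms(2) by (auto simp: cube_def PiE_iff)
  then show ?thesis using assms(1) by (auto simp: slice_def)
qed

text \<open>A copy of \<open>P\<close> lying in all slices at heights \<open>g 1, ..., g t\<close>
  is stacked: its coordinate maps are kept, and the last coordinate is sent from
  \<open>j * c\<close> to \<open>g j\<close>. The gap hypothesis is the expansion condition for this
  new map.\<close>

lemma contains_Qset:
  fixes g :: "nat \<Rightarrow> real"
  assumes "P \<noteq> {}" and t: "t \<ge> 1" and "c > 0"
    and T: "contains d T P" and g: "\<And>j. j \<in> {1..t} \<Longrightarrow> T \<subseteq> slice d S (g j)"
    and gap: "\<And>i j. i \<in> {1..t} \<Longrightarrow> j \<in> {1..t} \<Longrightarrow> i < j \<Longrightarrow> (real j - real i) * c \<le> g j - g i"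
  shows "contains (Suc d) S (Qset d P t c)"
proof -
  obtain f where
    f: "\<forall>i<d. \<forall>x\<in>coords i P. \<forall>x'\<in>coords i P.
          x > x' \<longrightarrow> (f i x - f i x') / (x - x') \<ge> 1"
       "\<forall>x\<in>P. (\<lambda>i\<in>{..<d}. f i (x i)) \<in> T"
    using T unfolding contains_def by (elim exE conjE)
  have f2: "(f i x - f i x') / (x - x') \<ge> 1"
    if "i < d" "x \<in> coords i P" "x' \<in> coords i P" "x' < x" for i x x'
    using f(1) that by blast
  have f3: "(\<lambda>i\<in>{..<d}. f i (x i)) \<in> T" if "x \<in> P" for x
    using f(2) that by blast
  \<comment> \<open>The floor recovers the index \<open>j\<close> from the height
    \<open>y = j * c\<close>.\<close>
  define F where "F = f(d := \<lambda>y. g (nat \<lfloor>y / c\<rfloor>))"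
  have Fd: "F d (real j * c) = g j" for j
    using \<open>c > 0\<close> by (simp add: F_def)
  have Fi: "F i = f i" if "i < d" for i
    using that by (simp add: F_def)
  \<comment> \<open>This also yields the range condition on each \<open>F i\<close>: every value in
    a coordinate set comes from a point of the pattern, whose image lies in
    \<open>S\<close>.\<close>
  have in_S: "(\<lambda>i\<in>{..<Suc d}. F i (x i)) \<in> S" if x: "x \<in> Qset d P t c" for x
  proof -
    obtain p j where p: "p \<in> P" and j: "j \<in> {1..t}" and xp: "x = p(d := real j * c)"
      using x by (auto simp: Qset_def)
    have "(\<lambda>i\<in>{..<Suc d}. F i (x i)) = (\<lambda>i\<in>{..<d}. f i (p i))(d := g j)"
      by (auto simp: fun_eq_iff xp Fd Fi restrict_def less_Suc_eq)
    also have "\<dots> \<in> S"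
      using f3[OF p] g[OF j] by (auto simp: slice_def)
    finally show ?thesis .
  qed
  show ?thesis
    unfolding contains_def
  proof (rule exI[of _ F], intro conjI allI impI ballI)
    fix i assume i: "i < Suc d"
    show "F i \<in> coords i (Qset d P t c) \<rightarrow> coords i S"
    proof
      fix v assume "v \<in> coords i (Qset d P t c)"
      then obtain x where x: "x \<in> Qset d P t c" "v = x i" by (auto simp: coords_def)
      have "F i v = (\<lambda>i\<in>{..<Suc d}. F i (x i)) i" using i x by simp
      then show "F i v \<in> coords i S"
        unfolding coords_def using in_S[OF x(1)] by blast
    qed
  next
    fix i v v'
    assume i: "i < Suc d" and v: "v \<in> coords i (Qset d P t c)"
      and v': "v' \<in> coords i (Qset d P t c)" and less: "v' < v"
    show "1 \<le> (F i v - F i v') / (v - v')"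
    proof (cases "i = d")
      case True
      have "\<exists>j\<in>{1..t}. w = real j * c" if "w \<in> coords d (Qset d P t c)" for w
        using that by (auto simp: coords_def Qset_def)
      then obtain j j' where jj: "j \<in> {1..t}" "v = real j * c" "j' \<in> {1..t}" "v' = real j' * c"
        using v v' True by metis
      with less \<open>c > 0\<close> have "j' < j" by simp
      moreover have "F i v = g j" "F i v' = g j'" using True Fd jj(2,4) by auto
      ultimately have "v - v' \<le> F i v - F i v'"
        using gap[OF jj(3,1)] by (simp add: jj(2,4) left_diff_distrib)
      with less show ?thesis by simp
    next
      case False
      with i have i: "i < d" by simp
      have "coords i (Qset d P t c) \<subseteq> coords i P"
        using i by (auto simp: coords_def Qset_def)
      then show ?thesis using f2[OF i _ _ less] v v' by (auto simp: Fi[OF i])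
    qed
  qed (rule in_S)
qed

lemma strict_mono_on_nat_gap:
  fixes e :: "nat \<Rightarrow> nat"
  assumes "\<And>i j. i < j \<Longrightarrow> j < n \<Longrightarrow> e i < e j" "i \<le> j" "j < n"
  shows "e i + (j - i) \<le> e j"
  using assms(2,3)
proof (induction j rule: dec_induct)
  case (step j)
  then have "e j < e (Suc j)" using assms(1) by simp
  with step show ?case by simp
qed simp

text \<open>The \<open>i\<close>-th and \<open>j\<close>-th smallest of \<open>t\<close> distinct
  integers differ by at least \<open>j - i\<close>. The corresponding heights therefore satisfy the
  gap condition of \<open>contains_Qset\<close>, and a copy of \<open>P\<close> in the intersection
  would produce a forbidden stack.\<close>

lemma not_contains_Inter_slices:
  fixes K :: "nat set"
  assumes "P \<noteq> {}" "t \<ge> 1" "c > 0" and free: "\<not> contains (Suc d) S (Qset d P t c)"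
    and K: "card K = t"
  shows "\<not> contains d (\<Inter>k\<in>K. slice d S (\<theta> + real k * c)) P"
proof
  assume *: "contains d (\<Inter>k\<in>K. slice d S (\<theta> + real k * c)) P"
  \<comment> \<open>An infinite set has \<open>card\<close> 0, which \<open>t \<ge> 1\<close>
    excludes.\<close>
  have finK: "finite K" using K \<open>t \<ge> 1\<close> card.infinite by fastforce
  \<comment> \<open>\<open>e\<close> enumerates \<open>K\<close> in increasing order from index 0,
    while the heights of the pattern are indexed from 1; hence the shift \<open>e (j - 1)\<close>
    below.\<close>
  define e where "e = (\<lambda>i. sorted_list_of_set K ! i)"
  have mono: "e i < e j" if "i < j" "j < t" for i j
    unfolding e_def using that K
    by (intro sorted_wrt_nth_less[OF strict_sorted_list_of_set]) auto
  have eK: "e i \<in> K" if "i < t" for i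
    unfolding e_def using that K finK
    by (metis length_sorted_list_of_set nth_mem set_sorted_list_of_set)
  have "contains (Suc d) S (Qset d P t c)"
  proof (rule contains_Qset[OF assms(1-3) *])
    fix j assume "j \<in> {1..t}"
    then have "e (j - 1) \<in> K" by (intro eK) auto
    then show "(\<Inter>k\<in>K. slice d S (\<theta> + real k * c)) \<subseteq> slice d S (\<theta> + real (e (j - 1)) * c)"
      by blast
  next
    fix i j assume ij: "i \<in> {1..t}" "j \<in> {1..t}" "i < j"
    then have "e (i - 1) + ((j - 1) - (i - 1)) \<le> e (j - 1)"
      by (intro strict_mono_on_nat_gap[of t] mono) auto
    with ij have "real j - real i \<le> real (e (j - 1)) - real (e (i - 1))" by simp
    from mult_right_mono[OF this, of c] \<open>c > 0\<close>
    show "(real j - real i) * c \<le> \<theta> + real (e (j - 1)) * c - (\<theta> + real (e (i - 1)) * c)"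
      by (simp add: algebra_simps)
  qed
  with free show False ..
qed

section \<open>Integration over the last coordinate\<close>

text \<open>The support is cut into \<open>N\<close> intervals of length \<open>c\<close>, each is
  translated to \<open>[0, c]\<close>, and sum and integral are exchanged. The integrand then
  becomes the sum over the grid with offset \<theta>, which is at most \<open>B\<close>.\<close>

lemma nn_integral_le_periodic_sum:
  fixes F :: "real \<Rightarrow> ennreal"
  assumes [measurable]: "F \<in> borel_measurable borel" and "c > 0"
    and supp: "\<And>y. y \<notin> {0..<real N * c} \<Longrightarrow> F y = 0"
    and bound: "\<And>\<theta>. (\<Sum>k<N. F (\<theta> + real k * c)) \<le> B"
  shows "(\<integral>\<^sup>+y. F y \<partial>lborel) \<le> B * ennreal c"
proof -
  \<comment> \<open>Only an inequality, because the closed intervals share endpoints. The support is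
    half-open on the right, so the index \<open>k\<close> of the interval found for \<open>y\<close>
    is below \<open>N\<close>.\<close>
  have "F y \<le> (\<Sum>k<N. F y * indicator {0..c} (y - real k * c))" for y
  proof (cases "y \<in> {0..<real N * c}")
    case True
    define k where "k = nat \<lfloor>y / c\<rfloor>"
    have y: "0 \<le> y / c" "y / c < real N"
      using True \<open>c > 0\<close> by (auto simp: field_simps)
    have k: "real k \<le> y / c" "y / c < real k + 1"
      using y by (auto simp: k_def)
    then have "k < N" using y by linarith
    have "y - real k * c \<in> {0..c}" using k \<open>c > 0\<close> by (auto simp: field_simps)
    then have "F y = F y * indicator {0..c} (y - real k * c)" by simp
    also have "\<dots> \<le> (\<Sum>k<N. F y * indicator {0..c} (y - real k * c))"
      using \<open>k < N\<close> by (intro member_le_sum) auto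
    finally show ?thesis .
  qed (simp add: supp)
  then have "(\<integral>\<^sup>+y. F y \<partial>lborel) \<le> (\<integral>\<^sup>+y. (\<Sum>k<N. F y * indicator {0..c} (y - real k * c)) \<partial>lborel)"
    by (intro nn_integral_mono)
  also have "\<dots> = (\<Sum>k<N. \<integral>\<^sup>+y. F y * indicator {0..c} (y - real k * c) \<partial>lborel)"
    by (rule nn_integral_sum) measurable
  also have "\<dots> = (\<Sum>k<N. \<integral>\<^sup>+\<theta>. F (\<theta> + real k * c) * indicator {0..c} \<theta> \<partial>lborel)"
  proof (rule sum.cong[OF refl])
    fix k
    show "(\<integral>\<^sup>+y. F y * indicator {0..c} (y - real k * c) \<partial>lborel)
        = (\<integral>\<^sup>+\<theta>. F (\<theta> + real k * c) * indicator {0..c} \<theta> \<partial>lborel)"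
      by (subst nn_integral_real_affine[where c = 1 and t = "real k * c"])
         (auto simp: add.commute)
  qed
  also have "\<dots> = (\<integral>\<^sup>+\<theta>. (\<Sum>k<N. F (\<theta> + real k * c) * indicator {0..c} \<theta>) \<partial>lborel)"
    by (rule nn_integral_sum[symmetric]) measurable
  also have "\<dots> \<le> (\<integral>\<^sup>+\<theta>. B * indicator {0..c} \<theta> \<partial>lborel)"
    unfolding sum_distrib_right[symmetric] by (intro nn_integral_mono mult_right_mono bound) simp
  also have "\<dots> = B * ennreal c"
    using \<open>c > 0\<close> by (subst nn_integral_cmult_indicator) auto
  finally show ?thesis .
qed

text \<open>Tonelli's theorem with index \<open>d\<close> split off from the product. Measurability
  in \<open>y\<close> follows from joint measurability of the update \<open>x(d := y)\<close> in
  \<open>y\<close> and \<open>x\<close>.\<close>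

lemma emeasure_slices:
  assumes "open_in_Rspace (Suc d) S"
  shows "(\<lambda>y. emeasure (lebesgue_Rspace d) (slice d S y)) \<in> borel_measurable borel"
    and "emeasure (lebesgue_Rspace (Suc d)) S
           = (\<integral>\<^sup>+y. emeasure (lebesgue_Rspace d) (slice d S y) \<partial>lborel)"
proof -
  interpret product_sigma_finite "\<lambda>_::nat. lborel :: real measure"
    by standard
  interpret sigma_finite_measure "lebesgue_Rspace d"
    unfolding lebesgue_Rspace_def by (rule sigma_finite) simp
  have S: "S \<in> sets (lebesgue_Rspace (Suc d))"
    by (rule open_in_Rspace_imp_sets[OF assms])
  have S': "S \<in> sets (PiM (insert d {..<d}) (\<lambda>_. lborel))"
    using S by (simp add: lebesgue_Rspace_def lessThan_Suc)
  have sec: "(\<integral>\<^sup>+x. indicator S (x(d := y)) \<partial>lebesgue_Rspace d)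
      = emeasure (lebesgue_Rspace d) (slice d S y)" for y
  proof -
    have "(\<integral>\<^sup>+x. indicator S (x(d := y)) \<partial>lebesgue_Rspace d)
        = (\<integral>\<^sup>+x. indicator (slice d S y) x \<partial>lebesgue_Rspace d)"
      by (intro nn_integral_cong) (auto simp: slice_def space_lebesgue_Rspace indicator_def)
    then show ?thesis
      using open_in_Rspace_imp_sets[OF open_slice[OF assms]] by simp
  qed
  have "(\<lambda>(y, x). x(d := y)) \<in> measurable (lborel \<Otimes>\<^sub>M PiM {..<d} (\<lambda>_. lborel))
      (PiM (insert d {..<d}) (\<lambda>_. lborel :: real measure))"
    by measurable
  then have "(\<lambda>(y, x). indicator S (x(d := y)) :: ennreal)
      \<in> borel_measurable (lborel \<Otimes>\<^sub>M lebesgue_Rspace d)"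
    using S' unfolding lebesgue_Rspace_def by measurable
  from borel_measurable_nn_integral[OF this]
  show "(\<lambda>y. emeasure (lebesgue_Rspace d) (slice d S y)) \<in> borel_measurable borel"
    by (simp add: sec)
  have "emeasure (lebesgue_Rspace (Suc d)) S
      = (\<integral>\<^sup>+x. indicator S x \<partial>PiM (insert d {..<d}) (\<lambda>_. lborel))"
    using S' by (simp add: lebesgue_Rspace_def lessThan_Suc)
  also have "\<dots> = (\<integral>\<^sup>+y. (\<integral>\<^sup>+x. indicator S (x(d := y)) \<partial>PiM {..<d} (\<lambda>_. lborel)) \<partial>lborel)"
    using S' by (intro product_nn_integral_insert_rev) auto
  finally show "emeasure (lebesgue_Rspace (Suc d)) S
      = (\<integral>\<^sup>+y. emeasure (lebesgue_Rspace d) (slice d S y) \<partial>lborel)"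
    using sec by (simp add: lebesgue_Rspace_def)
qed

section \<open>The bound for open sets free of the stacked pattern, and its asymptotic form\<close>

lemma measure_Qset_free_le:
  assumes "P \<noteq> {}" and t: "t \<ge> 1" and c: "c > 0" and n: "n > 0"
    and S: "open_in_Rspace (Suc d) S" "S \<subseteq> cube (Suc d) n"
    and free: "\<not> contains (Suc d) S (Qset d P t c)"
    and N: "n < real N * c"
  shows "measure (lebesgue_Rspace (Suc d)) S
           \<le> ((real t - 1) * n ^ d
               + 2 * real t * real N * opx n P d powr (1 / real t) * (n ^ d) powr (1 - 1 / real t)) * c"
    (is "_ \<le> ?B * c")
proof -
  let ?M = "lebesgue_Rspace d"
  let ?F = "\<lambda>y. emeasure ?M (slice d S y)"
  have B: "?B \<ge> 0" using t n by simp
  have fm: "slice d S y \<in> fmeasurable ?M" for y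
    using fmeasurableI2[OF cube_fmeasurable slice_subset_cube[OF S(2)]
        open_in_Rspace_imp_sets[OF open_slice[OF S(1)]]] n by simp
  have "(\<integral>\<^sup>+y. ?F y \<partial>lborel) \<le> ennreal ?B * ennreal c"
  proof (rule nn_integral_le_periodic_sum[OF emeasure_slices(1)[OF S(1)] c])
    fix y assume "y \<notin> {0..<real N * c}"
    then have "y \<notin> {0..n}" using N by auto
    then show "?F y = 0" using slice_eq_empty[OF S(2)] by simp
  next
    fix \<theta>
    have "(\<Sum>k<N. measure ?M (slice d S (\<theta> + real k * c)))
        \<le> (real t - 1) * measure ?M (cube d n) + 2 * real t * real (card {..<N})
             * opx n P d powr (1 / real t) * measure ?M (cube d n) powr (1 - 1 / real t)"
    proof (rule sum_measure_le)
      fix K :: "nat set" assume K: "K \<subseteq> {..<N}" "card K = t"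
      \<comment> \<open>Finiteness keeps the intersection open. Nonemptiness keeps it inside the
        cube, since the empty intersection is the set of all functions.\<close>
      then have fin: "finite K" "K \<noteq> {}" using t finite_subset by auto
      show "measure ?M (\<Inter>k\<in>K. slice d S (\<theta> + real k * c)) \<le> opx n P d"
      proof (rule measure_le_opx)
        show "open_in_Rspace d (\<Inter>k\<in>K. slice d S (\<theta> + real k * c))"
          using open_slice[OF S(1)] fin unfolding open_in_Rspace_def by (intro openin_INT2) auto
        show "(\<Inter>k\<in>K. slice d S (\<theta> + real k * c)) \<subseteq> cube d n"
          using slice_subset_cube[OF S(2)] fin by blast
        show "\<not> contains d (\<Inter>k\<in>K. slice d S (\<theta> + real k * c)) P"
          by (rule not_contains_Inter_slices[OF assms(1-3) free K(2)])
      qed (use n in simp)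
    qed (use n t fm slice_subset_cube[OF S(2)] cube_fmeasurable opx_nonneg[OF _ assms(1)] in
        \<open>auto simp: fmeasurable_def\<close>)
    also have "\<dots> = ?B" using n by (simp add: measure_cube)
    finally have "ennreal (\<Sum>k<N. measure ?M (slice d S (\<theta> + real k * c))) \<le> ennreal ?B"
      by (rule ennreal_leI)
    then show "(\<Sum>k<N. ?F (\<theta> + real k * c)) \<le> ennreal ?B"
      using fm by (simp add: sum_ennreal[symmetric] emeasure_eq_measure2[symmetric] del: sum_ennreal)
  qed
  then have "emeasure (lebesgue_Rspace (Suc d)) S \<le> ennreal (?B * c)"
    using B c by (simp add: emeasure_slices(2)[OF S(1)] ennreal_mult)
  then show ?thesis
    unfolding measure_def using B c by (intro enn2real_leI) auto
qed

theorem theorem5p16: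
  fixes t :: nat and c :: real
  assumes "t \<ge> 2" and "c > 0"
  shows "\<exists>C::real. C > 0 \<and>
    (\<forall>d::nat. \<forall>P. d \<ge> 1 \<longrightarrow> P \<subseteq> Rspace d \<longrightarrow> P \<noteq> {} \<longrightarrow>
      (\<forall>\<^sub>F n::real in at_top.
         opx n (Qset d P t c) (d + 1)
           \<le> C * (opx n P d powr (1 / real t) * n powr (real d + 1 - real d / real t) + n ^ d)))"
\<comment> \<open>\<open>4 * t\<close> is the factor \<open>2 * t\<close> of
  \<open>sum_measure_le\<close> times the 2 in \<open>N * c \<le> 2 * n\<close>;
  \<open>t * c\<close> bounds \<open>(t - 1) * c\<close> from the points in fewer than
  \<open>t\<close> slices. Neither \<open>d\<close> nor \<open>P\<close> enters.\<close>
proof (intro exI[of _ "4 * real t + real t * c"] conjI allI impI)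
  show "0 < 4 * real t + real t * c" using assms by (simp add: add_pos_pos)
next
  fix d :: nat and P :: "(nat \<Rightarrow> real) set"
  assume P: "P \<noteq> {}"
  then obtain x where "x \<in> P" by blast
  then have "x(d := real 1 * c) \<in> Qset d P t c"
    using assms(1) unfolding Qset_def
    by (intro CollectI exI[of _ x] exI[of _ "real 1 * c"] conjI refl imageI) auto
  then have Q: "Qset d P t c \<noteq> {}" by blast
  have "opx n (Qset d P t c) (d + 1) \<le> (4 * real t + real t * c)
      * (opx n P d powr (1 / real t) * n powr (real d + 1 - real d / real t) + n ^ d)"
    if n: "n \<ge> c" for n
  proof -
    \<comment> \<open>The added 1 makes \<open>n < N * c\<close> strict, so height \<open>n\<close>
      is covered by the half-open range. Since \<open>n \<ge> c\<close>, the rounding at most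
      doubles \<open>n / c\<close>.\<close>
    define N where "N = nat \<lfloor>n / c\<rfloor> + 1"
    define p where "p = opx n P d powr (1 / real t)"
    define q where "q = n powr (real d + 1 - real d / real t)"
    have npos: "n > 0" using n assms by simp
    have "n / c \<ge> 1" using n assms by simp
    then have N: "n / c < real N" "real N \<le> 2 * (n / c)"
      unfolding N_def by linarith+
    then have Nc: "n < real N * c" "real N * c \<le> 2 * n"
      using assms by (auto simp: field_simps)
    have "(n ^ d) powr (1 - 1 / real t) = n powr (real d - real d / real t)"
      using npos by (simp add: powr_realpow[symmetric] powr_powr algebra_simps)
    \<comment> \<open>The extra factor \<open>n\<close>, supplied by \<open>N * c\<close>, raises
      the exponent \<open>d - d / t\<close> by 1.\<close>
    then have nq: "n * (n ^ d) powr (1 - 1 / real t) = q"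
      using npos by (simp add: q_def powr_mult_base algebra_simps)
    have "opx n (Qset d P t c) (Suc d)
        \<le> ((real t - 1) * n ^ d + 2 * real t * real N * p * (n ^ d) powr (1 - 1 / real t)) * c"
      unfolding p_def using assms npos Nc(1) by (intro opx_le[OF Q] measure_Qset_free_le[OF P]) auto
    also have "\<dots> = (real t - 1) * c * n ^ d
        + 2 * real t * p * (n ^ d) powr (1 - 1 / real t) * (real N * c)"
      by (simp add: algebra_simps)
    also have "\<dots> \<le> real t * c * n ^ d
        + 2 * real t * p * (n ^ d) powr (1 - 1 / real t) * (2 * n)"
      using assms npos Nc(2) by (intro add_mono mult_right_mono mult_left_mono) (auto simp: p_def)
    also have "\<dots> = real t * c * n ^ d + 4 * real t * (p * q)"
      by (simp add: nq[symmetric])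
    also have "\<dots> \<le> (4 * real t + real t * c) * (p * q + n ^ d)"
    proof -
      have "0 \<le> real t * c * (p * q)" "0 \<le> 4 * real t * n ^ d"
        using assms npos by (auto simp: p_def q_def)
      then show ?thesis by (simp add: algebra_simps)
    qed
    finally show ?thesis by (simp add: p_def q_def)
  qed
  then show "\<forall>\<^sub>F n::real in at_top. opx n (Qset d P t c) (d + 1) \<le> (4 * real t + real t * c)
      * (opx n P d powr (1 / real t) * n powr (real d + 1 - real d / real t) + n ^ d)"
    using eventually_ge_at_top[of c] by (rule eventually_mono[rotated])
qed

end
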